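(* For the two-dimensional Euler equations, consider the two-point numerical fluxes $$f^{x}_{\rho}=(\gamma-1)\left(\frac{\gamma}{\{\{\rho\}\}_{\log}}-\frac{\{\{p^{-1}\}\}\{\{p\}\}_{\mathrm{geo}}^2}{\{\{\rho\}\}\{\{p\}\}_{\log}}\right)^{-1}\{\{v_x\}\},\quad f^x_{\rho v_x}=\{\{v_x\}\}f^x_\rho+\frac{\{\{\rho\}\}}{\{\{\rho/p\}\}},\quad f^x_{\rho v_y}=\{\{v_y\}\}f^x_\rho,$$ $$f^x_{\rho e}=\left(\frac{1}{\gamma-1}\frac{\{\{p\}\}_{\mathrm{geo}}^2}{\{\{\rho\}\}\{\{p\}\}_{\log}}+\{\{v_x\}\}^2+\{\{v_y\}\}^2-\frac{\{\{v_x^2\}\}+\{\{v_y^2\}\}}{2}\right)f^x_\rho+\frac{\{\{\rho\}\}\{\{v_x\}\}}{\{\{\rho/p\}\}},$$ and $$f^{y}_{\rho}=(\gamma-1)\left(\frac{\gamma}{\{\{\rho\}\}_{\log}}-\frac{\{\{p^{-1}\}\}\{\{p\}\}_{\mathrm{geo}}^2}{\{\{\rho\}\}\{\{p\}\}_{\log}}\right)^{-1}\{\{v_y\}\},\quad f^y_{\rho v_x}=\{\{v_x\}\}f^y_\rho,\quad f^y_{\rho v_y}=\{\{v_y\}\}f^y_\rho+\frac{\{\{\rho\}\}}{\{\{\rho/p\}\}},$$ $$f^y_{\rho e}=\left(\frac{1}{\gamma-1}\frac{\{\{p\}\}_{\mathrm{geo}}^2}{\{\{\rho\}\}\{\{p\}\}_{\log}}+\{\{v_x\}\}^2+\{\{v_y\}\}^2-\frac{\{\{v_x^2\}\}+\{\{v_y^2\}\}}{2}\right)f^y_\rho+\frac{\{\{\rho\}\}\{\{v_y\}\}}{\{\{\rho/p\}\}}.$$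 These fluxes are entropy conservative and consistent. Additionally, they are kinetic energy preserving with numerical pressure flux $p^{\mathrm{num}}=\{\{\rho\}\}/\{\{\rho/p\}\}$.
   Context: Euler equations: $\partial_tu+\partial_xf_x(u)+\partial_yf_y(u)=0$, $u=(\rho,\rho v_x,\rho v_y,\rho e)^T$, $f_x=(\rho v_x,\rho v_x^2+p,\rho v_xv_y,(\rho e+p)v_x)^T$, $f_y=(\rho v_y,\rho v_xv_y,\rho v_y^2+p,(\rho e+p)v_y)^T$, $p=(\gamma-1)(\rho e-\frac12\rho v^2)$, $v^2=v_x^2+v_y^2$, $\gamma>1$ the constant ratio of specific heats, $\rho,p>0$. With $s=\log(p/\rho^\gamma)$, the entropy is $U=-\rho s/(\gamma-1)$, the entropy variables are $w=U'(u)=\left(\frac{\gamma}{\gamma-1}-\frac{s}{\gamma-1}-\frac{\rho v^2}{2p},\frac{\rho v_x}{p},\frac{\rho v_y}{p},-\frac{\rho}{p}\right)^T$ and the flux potentials are $\psi_x=\rho v_x$, $\psi_y=\rho v_y$. Means of a quantity $a$ with values $a_-,a_+$ at the states $u_-,u_+$: $\{\{a\}\}=\frac{a_-+a_+}2$; for $a_\pm>0$, $\{\{a\}\}_{\log}=\frac{a_+-a_-}{\log a_+-\log a_-}$ (and $=a$ if $a_-=a_+=a$) and $\{\{a\}\}_{\mathrm{geo}}=\sqrt{a_+a_-}$. A two-point flux $f^j=(f^j_\rho,f^j_{\rho v_x},f^j_{\rho v_y},f^j_{\rho e})^T(u_-,u_+)$, $j\in\{x,y\}$, is consistent if $f^j(u,u)=f_j(u)$;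 entropy conservative if $(w_+-w_-)\cdot f^j(u_-,u_+)-(\psi_{j,+}-\psi_{j,-})=0$; kinetic energy preserving with numerical pressure flux $p^{\mathrm{num}}$ if $f^j_{\rho v_j}=\{\{v_j\}\}f^j_\rho+p^{\mathrm{num}}$ with $p^{\mathrm{num}}$ a consistent approximation of the pressure, i.e. $p^{\mathrm{num}}(u,u)=p$.
   Formalization: Entropy conservation is stated only for pairs of states at which the bracket inverted in the mass flux is nonzero; for some widely different pressures that bracket vanishes and the flux is undefined. *)

theory Defs
  imports "HOL-Analysis.Analysis"
begin

(* Conserved variables: u = (rho, rho v_x, rho v_y, rho e). *)
type_synonym state = "real ^ 4"
type_synonym two_point_flux = "state \<Rightarrow> state \<Rightarrow> real ^ 4"

datatype direction = X | Y

definition mass_density :: "state \<Rightarrow> real" where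
  "mass_density u = u $ 1"

fun momentum_index :: "direction \<Rightarrow> 4" where
  "momentum_index X = 2"
| "momentum_index Y = 3"

definition velocity :: "direction \<Rightarrow> state \<Rightarrow> real" where
  "velocity j u = u $ momentum_index j / mass_density u"

definition total_energy :: "state \<Rightarrow> real" where
  "total_energy u = u $ 4"

definition speed_squared :: "state \<Rightarrow> real" where
  "speed_squared u = (velocity X u)\<^sup>2 + (velocity Y u)\<^sup>2"

definition pressure :: "real \<Rightarrow> state \<Rightarrow> real" where
  "pressure \<gamma> u = (\<gamma> - 1) * (total_energy u - 1 / 2 * mass_density u * speed_squared u)"

definition states :: "real \<Rightarrow> state set" where
  "states \<gamma> = {u. mass_density u > 0 \<and> pressure \<gamma> u > 0}"

fun physical_flux :: "real \<Rightarrow> direction \<Rightarrow> state \<Rightarrow> real ^ 4" where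
  "physical_flux \<gamma> X u =
    vector [mass_density u * velocity X u,
            mass_density u * (velocity X u)\<^sup>2 + pressure \<gamma> u,
            mass_density u * velocity X u * velocity Y u,
            (total_energy u + pressure \<gamma> u) * velocity X u]"
| "physical_flux \<gamma> Y u =
    vector [mass_density u * velocity Y u,
            mass_density u * velocity X u * velocity Y u,
            mass_density u * (velocity Y u)\<^sup>2 + pressure \<gamma> u,
            (total_energy u + pressure \<gamma> u) * velocity Y u]"

definition specific_entropy :: "real \<Rightarrow> state \<Rightarrow> real" where
  "specific_entropy \<gamma> u = ln (pressure \<gamma> u / mass_density u powr \<gamma>)"

definition entropy :: "real \<Rightarrow> state \<Rightarrow> real" where
  "entropy \<gamma> u = - (mass_density u * specific_entropy \<gamma> u / (\<gamma> - 1))"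

(* The gradient of the entropy; see gderiv_entropy below. *)
definition entropy_variables :: "real \<Rightarrow> state \<Rightarrow> real ^ 4" where
  "entropy_variables \<gamma> u =
    vector [\<gamma> / (\<gamma> - 1) - specific_entropy \<gamma> u / (\<gamma> - 1)
              - mass_density u * speed_squared u / (2 * pressure \<gamma> u),
            mass_density u * velocity X u / pressure \<gamma> u,
            mass_density u * velocity Y u / pressure \<gamma> u,
            - (mass_density u / pressure \<gamma> u)]"

definition flux_potential :: "direction \<Rightarrow> state \<Rightarrow> real" where
  "flux_potential j u = mass_density u * velocity j u"


(* Means of a quantity a, given as a function of the state. *)

definition mean :: "(state \<Rightarrow> real) \<Rightarrow> state \<Rightarrow> state \<Rightarrow> real" where
  "mean a um up = (a um + a up) / 2"

definition log_mean :: "(state \<Rightarrow> real) \<Rightarrow> state \<Rightarrow> state \<Rightarrow> real" where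
  "log_mean a um up =
    (if a um = a up then a um else (a up - a um) / (ln (a up) - ln (a um)))"

definition geo_mean :: "(state \<Rightarrow> real) \<Rightarrow> state \<Rightarrow> state \<Rightarrow> real" where
  "geo_mean a um up = sqrt (a up * a um)"


definition consistent :: "real \<Rightarrow> direction \<Rightarrow> two_point_flux \<Rightarrow> bool" where
  "consistent \<gamma> j f \<longleftrightarrow> (\<forall>u \<in> states \<gamma>. f u u = physical_flux \<gamma> j u)"

(* W is the set of pairs of states at which the flux f is defined. *)
definition entropy_conservative_on ::
    "(state \<times> state) set \<Rightarrow> real \<Rightarrow> direction \<Rightarrow> two_point_flux \<Rightarrow> bool" where
  "entropy_conservative_on W \<gamma> j f \<longleftrightarrow>
    (\<forall>(um, up) \<in> W.
      (entropy_variables \<gamma> up - entropy_variables \<gamma> um) \<bullet> f um up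
        - (flux_potential j up - flux_potential j um) = 0)"

definition kinetic_energy_preserving ::
    "real \<Rightarrow> direction \<Rightarrow> two_point_flux \<Rightarrow> (state \<Rightarrow> state \<Rightarrow> real) \<Rightarrow> bool" where
  "kinetic_energy_preserving \<gamma> j f p_num \<longleftrightarrow>
    (\<forall>um \<in> states \<gamma>. \<forall>up \<in> states \<gamma>.
      f um up $ momentum_index j = mean (velocity j) um up * f um up $ 1 + p_num um up) \<and>
    (\<forall>u \<in> states \<gamma>. p_num u u = pressure \<gamma> u)"


definition flux_denominator :: "real \<Rightarrow> state \<Rightarrow> state \<Rightarrow> real" where
  "flux_denominator \<gamma> um up =
    \<gamma> / log_mean mass_density um up
      - mean (\<lambda>u. inverse (pressure \<gamma> u)) um up * (geo_mean (pressure \<gamma>) um up)\<^sup>2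
        / (mean mass_density um up * log_mean (pressure \<gamma>) um up)"

(* The mass flux contains the reciprocal of flux_denominator, which vanishes at some
   pairs of states with widely different pressures.  The numerical fluxes are defined
   exactly where it does not; all their other denominators are positive. *)
definition flux_domain :: "real \<Rightarrow> (state \<times> state) set" where
  "flux_domain \<gamma> =
    {(um, up). um \<in> states \<gamma> \<and> up \<in> states \<gamma> \<and> flux_denominator \<gamma> um up \<noteq> 0}"

definition mass_flux :: "real \<Rightarrow> direction \<Rightarrow> state \<Rightarrow> state \<Rightarrow> real" where
  "mass_flux \<gamma> j um up =
    (\<gamma> - 1) * inverse (flux_denominator \<gamma> um up) * mean (velocity j) um up"

definition pressure_flux :: "real \<Rightarrow> state \<Rightarrow> state \<Rightarrow> real" where
  "pressure_flux \<gamma> um up =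
    mean mass_density um up / mean (\<lambda>u. mass_density u / pressure \<gamma> u) um up"

definition energy_flux :: "real \<Rightarrow> direction \<Rightarrow> state \<Rightarrow> state \<Rightarrow> real" where
  "energy_flux \<gamma> j um up =
    (1 / (\<gamma> - 1) * ((geo_mean (pressure \<gamma>) um up)\<^sup>2
        / (mean mass_density um up * log_mean (pressure \<gamma>) um up))
      + (mean (velocity X) um up)\<^sup>2 + (mean (velocity Y) um up)\<^sup>2
      - (mean (\<lambda>u. (velocity X u)\<^sup>2) um up + mean (\<lambda>u. (velocity Y u)\<^sup>2) um up) / 2)
      * mass_flux \<gamma> j um up
    + mean mass_density um up * mean (velocity j) um up
      / mean (\<lambda>u. mass_density u / pressure \<gamma> u) um up"

fun num_flux :: "real \<Rightarrow> direction \<Rightarrow> two_point_flux" where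
  "num_flux \<gamma> X um up =
    vector [mass_flux \<gamma> X um up,
            mean (velocity X) um up * mass_flux \<gamma> X um up + pressure_flux \<gamma> um up,
            mean (velocity Y) um up * mass_flux \<gamma> X um up,
            energy_flux \<gamma> X um up]"
| "num_flux \<gamma> Y um up =
    vector [mass_flux \<gamma> Y um up,
            mean (velocity X) um up * mass_flux \<gamma> Y um up,
            mean (velocity Y) um up * mass_flux \<gamma> Y um up + pressure_flux \<gamma> um up,
            energy_flux \<gamma> Y um up]"


lemma vector_4_nth:
  "(vector [a, b, c, d] :: real ^ 4) $ 1 = a"
  "(vector [a, b, c, d] :: real ^ 4) $ 2 = b"
  "(vector [a, b, c, d] :: real ^ 4) $ 3 = c"
  "(vector [a, b, c, d] :: real ^ 4) $ 4 = d"
  unfolding vector_def by simp_all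

lemma inner_4: "(x :: real ^ 4) \<bullet> y = x $ 1 * y $ 1 + x $ 2 * y $ 2 + x $ 3 * y $ 3 + x $ 4 * y $ 4"
  by (simp add: inner_vec_def sum_4)

lemma pressure_alt:
  assumes "mass_density u \<noteq> 0"
  shows "pressure \<gamma> u = (\<gamma> - 1) * (u $ 4 - ((u $ 2)\<^sup>2 + (u $ 3)\<^sup>2) / (2 * u $ 1))"
  using assms
  by (simp add: pressure_def speed_squared_def velocity_def mass_density_def total_energy_def
      field_simps power2_eq_square)

lemma gderiv_entropy:
  assumes \<gamma>: "\<gamma> > 1" and u: "u \<in> states \<gamma>"
  shows "GDERIV (entropy \<gamma>) u :> entropy_variables \<gamma> u"
proof -
  define P where "P = (\<lambda>u :: state. (\<gamma> - 1) * (u $ 4 - ((u $ 2)\<^sup>2 + (u $ 3)\<^sup>2) / (2 * u $ 1)))"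
  define W where "W = {u :: state. u $ 1 > 0} \<inter> {u. P u > 0}"
  have P: "pressure \<gamma> v = P v" if "v $ 1 > 0" for v
    using pressure_alt[of v \<gamma>] that by (simp add: P_def mass_density_def)
  have pos: "u $ 1 > 0" "P u > 0" and uW: "u \<in> W"
    using u P[of u] by (auto simp: states_def mass_density_def W_def)
  have "open {u :: state. u $ 1 > 0}"
    by (intro open_Collect_less continuous_intros)
  moreover have "continuous_on {u. u $ 1 > 0} P"
    unfolding P_def by (intro continuous_intros) auto
  ultimately have "open W"
    using continuous_open_preimage[of "{u. u $ 1 > 0}" P "{0<..}"]
    by (simp add: W_def vimage_def)
  have s: "specific_entropy \<gamma> v = ln (P v) - \<gamma> * ln (v $ 1)" if "v \<in> W" for v
    using that P[of v]
    by (simp add: W_def specific_entropy_def ln_div ln_powr mass_density_def)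
  note comp = bounded_linear_imp_has_derivative[OF bounded_linear_vec_nth]
  have P': "(P has_derivative (\<lambda>h. (\<gamma> - 1) * (h $ 4
        - (u $ 2 * h $ 2 + u $ 3 * h $ 3) / u $ 1
        + ((u $ 2)\<^sup>2 + (u $ 3)\<^sup>2) / (2 * (u $ 1)\<^sup>2) * h $ 1))) (at u)"
    unfolding P_def
    apply (rule has_derivative_eq_rhs)
     apply (rule derivative_intros comp)+
    using pos apply simp
    using pos apply (simp add: fun_eq_iff divide_simps)
    apply (simp add: algebra_simps power2_eq_square)
    done
  have "((\<lambda>v. - (v $ 1 * (ln (P v) - \<gamma> * ln (v $ 1)) / (\<gamma> - 1)))
        has_derivative (\<lambda>h. - ((u $ 1 * ((\<gamma> - 1) * (h $ 4
            - (u $ 2 * h $ 2 + u $ 3 * h $ 3) / u $ 1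
            + ((u $ 2)\<^sup>2 + (u $ 3)\<^sup>2) / (2 * (u $ 1)\<^sup>2) * h $ 1) / P u
          - \<gamma> * (h $ 1 / u $ 1)) + h $ 1 * (ln (P u) - \<gamma> * ln (u $ 1))) / (\<gamma> - 1)))) (at u)"
    apply (rule has_derivative_eq_rhs)
     apply (rule has_derivative_minus has_derivative_divide' has_derivative_mult
       has_derivative_diff has_derivative_ln has_derivative_const has_derivative_mult_right
       comp P' pos)+
    using \<gamma> apply simp
    using pos \<gamma> apply (simp add: fun_eq_iff)
    apply (simp add: field_simps)
    done
  also have "(\<lambda>h. - ((u $ 1 * ((\<gamma> - 1) * (h $ 4
            - (u $ 2 * h $ 2 + u $ 3 * h $ 3) / u $ 1
            + ((u $ 2)\<^sup>2 + (u $ 3)\<^sup>2) / (2 * (u $ 1)\<^sup>2) * h $ 1) / P u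
          - \<gamma> * (h $ 1 / u $ 1)) + h $ 1 * (ln (P u) - \<gamma> * ln (u $ 1))) / (\<gamma> - 1)))
      = (\<lambda>h. h \<bullet> entropy_variables \<gamma> u)" (is "?L = ?R")
  proof
    fix h
    obtain g where g: "\<gamma> = 1 + g" "g > 0"
      using \<gamma> by (metis add.commute diff_add_cancel diff_gt_0_iff_gt)
    show "?L h = ?R h"
      unfolding entropy_variables_def inner_4 vector_4_nth P[OF pos(1)] s[OF uW]
        mass_density_def velocity_def speed_squared_def momentum_index.simps
      using pos g(2) by (simp add: g(1) field_simps power2_eq_square)
  qed
  finally have "((\<lambda>v. - (v $ 1 * (ln (P v) - \<gamma> * ln (v $ 1)) / (\<gamma> - 1)))
        has_derivative (\<lambda>h. h \<bullet> entropy_variables \<gamma> u)) (at u)" .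
  then show ?thesis
    unfolding gderiv_def
    by (rule has_derivative_transform_within_open[OF _ \<open>open W\<close> uW])
      (simp add: entropy_def s mass_density_def)
qed

lemma flux_domain_diagonal:
  assumes "\<gamma> > 1" "u \<in> states \<gamma>"
  shows "(u, u) \<in> flux_domain \<gamma>"
  using assms
  by (auto simp: flux_domain_def flux_denominator_def log_mean_def mean_def geo_mean_def
      states_def divide_simps power2_eq_square)

end

theory Submission
  imports Defs
begin

text \<open>
  Write [a] for the jump a(u+) - a(u-). The product rules [a b] = {{a}}[b] + {{b}}[a] cancel all
  velocities from the factor of the mass flux in [w] . f, except for the pressure flux
  contribution {{rho/p}} p_num [v] = {{rho}}[v]. The factor that remains equals [rho] times the
  denominator of the mass flux, divided by gamma - 1, because [log a] = [a] / {{a}}_log and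
  [1/p] = -[p] / {{p}}_geo^2. Together these give {{rho}}[v] + {{v}}[rho] = [rho v] = [psi].
\<close>

lemma log_mean_pos:
  assumes "a um > 0" "a up > 0"
  shows "log_mean a um up > 0"
  using assms
  by (cases "a um" "a up" rule: linorder_cases)
    (auto simp: log_mean_def divide_pos_pos divide_neg_neg)

text \<open>This solves the defining quotient of the logarithmic mean for the jump of the logarithm.
  If the two values agree, both sides are 0.\<close>

lemma ln_jump:
  assumes "a um > 0" "a up > 0"
  shows "ln (a up) - ln (a um) = (a up - a um) / log_mean a um up"
  using assms by (auto simp: log_mean_def)

lemma specific_entropy_eq:
  assumes "u \<in> states \<gamma>"
  shows "specific_entropy \<gamma> u = ln (pressure \<gamma> u) - \<gamma> * ln (mass_density u)"
  using assms by (simp add: specific_entropy_def states_def ln_div ln_powr)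

lemma total_energy_eq:
  assumes "\<gamma> \<noteq> 1"
  shows "total_energy u = pressure \<gamma> u / (\<gamma> - 1) + mass_density u * speed_squared u / 2"
  using assms by (simp add: pressure_def)

text \<open>The weight multiplying the jump of rho/p is chosen so that the pressure jumps cancel:
  what remains is proportional to the density jump, with exactly the denominator of the mass flux as
  its factor.\<close>

lemma specific_entropy_jump:
  assumes um: "um \<in> states \<gamma>" and up: "up \<in> states \<gamma>"
  shows "- (specific_entropy \<gamma> up - specific_entropy \<gamma> um)
      - (mass_density up / pressure \<gamma> up - mass_density um / pressure \<gamma> um)
        * ((geo_mean (pressure \<gamma>) um up)\<^sup>2
            / (mean mass_density um up * log_mean (pressure \<gamma>) um up))
    = (mass_density up - mass_density um) * flux_denominator \<gamma> um up"
proof -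
  define r R p P where "r = mass_density um" and "R = mass_density up"
    and "p = pressure \<gamma> um" and "P = pressure \<gamma> up"
  define lr lp where "lr = log_mean mass_density um up" and "lp = log_mean (pressure \<gamma>) um up"
  note defs = r_def R_def p_def P_def lr_def lp_def
  have pos: "r > 0" "R > 0" "p > 0" "P > 0"
    using um up by (auto simp: states_def defs)
  then have lpos: "lr > 0" "lp > 0"
    unfolding defs by (auto intro: log_mean_pos)
  have s: "specific_entropy \<gamma> up - specific_entropy \<gamma> um = (P - p) / lp - \<gamma> * ((R - r) / lr)"
  proof -
    have "specific_entropy \<gamma> up - specific_entropy \<gamma> um = (ln P - ln p) - \<gamma> * (ln R - ln r)"
      by (simp add: specific_entropy_eq[OF um] specific_entropy_eq[OF up] defs right_diff_distrib)
    moreover have "ln P - ln p = (P - p) / lp" "ln R - ln r = (R - r) / lr"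
      using pos by (simp_all add: ln_jump defs)
    ultimately show ?thesis
      by simp
  qed
  have geo: "(geo_mean (pressure \<gamma>) um up)\<^sup>2 = P * p"
    using pos by (simp add: geo_mean_def defs)
  \<comment> \<open>Discrete product rule for rho * (1/p), with [1/p] = -[p] / (p P).\<close>
  have "R / P - r / p = (R - r) * ((1 / p + 1 / P) / 2) - (r + R) / 2 * ((P - p) / (P * p))"
    using pos by (simp add: field_simps)
  \<comment> \<open>The weight turns the pressure term into \<open>(P - p) / lp\<close>, which is
    the jump of ln p occurring in \<open>s\<close>.\<close>
  then have "(R / P - r / p) * (P * p / ((r + R) / 2 * lp))
      = (R - r) * ((1 / p + 1 / P) / 2 * (P * p) / ((r + R) / 2 * lp)) - (P - p) / lp"
    using pos lpos by (simp add: divide_simps) (simp add: algebra_simps)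
  then show ?thesis
    unfolding s geo flux_denominator_def mean_def defs[symmetric]
    by (simp add: inverse_eq_divide algebra_simps)
qed

text \<open>Here \<open>b\<close>, \<open>B\<close> stand for rho/p, \<open>x\<close>,
  \<open>x'\<close> for the velocity normal to the interface and \<open>y\<close>, \<open>y'\<close>
  for the tangential one. The quadratic velocity terms cancel by [b x] {{x}} = {{b}} [x^2]/2 + [b]
  {{x}}^2 and [b x^2] = {{b}} [x^2] + {{x^2}} [b]; of the \<open>q\<close> terms, [b x] - [b] {{x}}
  = {{b}} [x] survives.\<close>

lemma entropy_production_identity:
  fixes b B x x' y y' F q E s k S :: real
  shows "(- (S - s) / k - (B * (x'\<^sup>2 + y'\<^sup>2) - b * (x\<^sup>2 + y\<^sup>2)) / 2) * F
      + (B * x' - b * x) * ((x + x') / 2 * F + q) + (B * y' - b * y) * ((y + y') / 2 * F)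
      + (b - B) * ((E + ((x + x') / 2)\<^sup>2 + ((y + y') / 2)\<^sup>2
          - ((x\<^sup>2 + x'\<^sup>2) / 2 + (y\<^sup>2 + y'\<^sup>2) / 2) / 2) * F + q * ((x + x') / 2))
    = (- (S - s) / k - (B - b) * E) * F + (b + B) / 2 * q * (x' - x)"
proof -
  \<comment> \<open>The quotient by the arbitrary \<open>k\<close> is the same on both sides, so it
    is treated as an atom.\<close>
  define c where "c = - (S - s) / k"
  show ?thesis
    unfolding c_def[symmetric] by (simp add: field_simps power2_eq_square)
qed

lemma num_flux_entropy_conservative:
  assumes \<gamma>: "\<gamma> > 1"
  shows "entropy_conservative_on (flux_domain \<gamma>) \<gamma> j (num_flux \<gamma> j)"
  unfolding entropy_conservative_on_def
proof clarify
  fix um up assume dom: "(um, up) \<in> flux_domain \<gamma>"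
  then have um: "um \<in> states \<gamma>" and up: "up \<in> states \<gamma>"
    and D: "flux_denominator \<gamma> um up \<noteq> 0"
    by (auto simp: flux_domain_def)
  define r R b B where "r = mass_density um" and "R = mass_density up"
    and "b = mass_density um / pressure \<gamma> um" and "B = mass_density up / pressure \<gamma> up"
  define s S where "s = specific_entropy \<gamma> um" and "S = specific_entropy \<gamma> up"
  define x x' y y' where "x = velocity X um" and "x' = velocity X up"
    and "y = velocity Y um" and "y' = velocity Y up"
  define F where "F = mass_flux \<gamma> j um up"
  define q where "q = pressure_flux \<gamma> um up"
  define E where "E = 1 / (\<gamma> - 1) * ((geo_mean (pressure \<gamma>) um up)\<^sup>2
        / (mean mass_density um up * log_mean (pressure \<gamma>) um up))"
  note defs = r_def R_def b_def B_def s_def S_def x_def x'_def y_def y'_def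
  have pos: "b > 0" "B > 0"
    using um up by (auto simp: states_def defs)
  then have bB: "b + B \<noteq> 0"
    by simp
  have q: "(b + B) / 2 * q = (r + R) / 2"
  proof -
    have "q = (r + R) / 2 / ((b + B) / 2)"
      by (simp add: q_def pressure_flux_def mean_def defs)
    then show ?thesis
      using bB by (metis divide_eq_0_iff nonzero_mult_div_cancel_left times_divide_eq_right zero_neq_numeral)
  qed
  have "- (S - s) / (\<gamma> - 1) - (B - b) * E
      = (R - r) * flux_denominator \<gamma> um up / (\<gamma> - 1)"
    unfolding specific_entropy_jump[OF um up, symmetric] defs E_def
    by (simp add: diff_divide_distrib)
  \<comment> \<open>Membership in \<open>flux_domain\<close> enters here: the nonzero denominator
    cancels against the one in \<open>mass_flux\<close>.\<close>
  then have F: "(- (S - s) / (\<gamma> - 1) - (B - b) * E) * F = (R - r) * mean (velocity j) um up"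
    using D \<gamma> by (simp add: F_def mass_flux_def)
  have e: "energy_flux \<gamma> j um up =
      (E + ((x + x') / 2)\<^sup>2 + ((y + y') / 2)\<^sup>2
          - ((x\<^sup>2 + x'\<^sup>2) / 2 + (y\<^sup>2 + y'\<^sup>2) / 2) / 2) * F + q * mean (velocity j) um up"
    by (simp add: energy_flux_def E_def F_def q_def pressure_flux_def defs
        mean_def[of "velocity _"] mean_def[of "\<lambda>u. (velocity _ u)\<^sup>2"])
  have w: "entropy_variables \<gamma> up - entropy_variables \<gamma> um =
      vector [- (S - s) / (\<gamma> - 1) - (B * (x'\<^sup>2 + y'\<^sup>2) - b * (x\<^sup>2 + y\<^sup>2)) / 2,
        B * x' - b * x, B * y' - b * y, - (B - b)]"
    by (simp add: vec_eq_iff forall_4 vector_4_nth entropy_variables_def speed_squared_def defs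
        diff_divide_distrib)
  show "(entropy_variables \<gamma> up - entropy_variables \<gamma> um) \<bullet> num_flux \<gamma> j um up
      - (flux_potential j up - flux_potential j um) = 0"
  proof (cases j)
    case X
    have v: "mean (velocity j) um up = (x + x') / 2"
      by (simp add: mean_def X defs)
    have "(entropy_variables \<gamma> up - entropy_variables \<gamma> um) \<bullet> num_flux \<gamma> j um up
        = (- (S - s) / (\<gamma> - 1) - (B - b) * E) * F + (b + B) / 2 * q * (x' - x)"
      using entropy_production_identity[of S s "\<gamma> - 1" B x' y' b x y F q E] e v
      unfolding w inner_4 X num_flux.simps vector_4_nth
      by (simp add: F_def q_def X mean_def flip: defs)
    \<comment> \<open>The product rule {{v}}[rho] + {{rho}}[v] = [rho v].\<close>
    also have "\<dots> = R * x' - r * x"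
      unfolding F q v by (simp add: field_simps)
    finally show ?thesis
      by (simp add: flux_potential_def X defs)
  next
    case Y
    have v: "mean (velocity j) um up = (y + y') / 2"
      by (simp add: mean_def Y defs)
    have "(entropy_variables \<gamma> up - entropy_variables \<gamma> um) \<bullet> num_flux \<gamma> j um up
        = (- (S - s) / (\<gamma> - 1) - (B - b) * E) * F + (b + B) / 2 * q * (y' - y)"
      \<comment> \<open>The velocity components trade places, since y is now the normal
        direction.\<close>
      using entropy_production_identity[of S s "\<gamma> - 1" B y' x' b y x F q E] e v
      unfolding w inner_4 Y num_flux.simps vector_4_nth
      by (simp add: F_def q_def Y mean_def add_ac flip: defs)
    also have "\<dots> = R * y' - r * y"
      unfolding F q v by (simp add: field_simps)
    finally show ?thesis
      by (simp add: flux_potential_def Y defs)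
  qed
qed

lemma pressure_flux_diagonal:
  assumes "u \<in> states \<gamma>"
  shows "pressure_flux \<gamma> u u = pressure \<gamma> u"
  using assms by (simp add: pressure_flux_def mean_def states_def)

lemma mass_flux_diagonal:
  assumes "\<gamma> > 1" "u \<in> states \<gamma>"
  shows "mass_flux \<gamma> j u u = mass_density u * velocity j u"
proof -
  \<comment> \<open>All means collapse to point values, leaving \<gamma>/rho - 1/rho.\<close>
  have "flux_denominator \<gamma> u u = (\<gamma> - 1) / mass_density u"
    using assms
    by (auto simp: flux_denominator_def log_mean_def mean_def geo_mean_def states_def
        field_simps power2_eq_square)
  then show ?thesis
    using assms by (simp add: mass_flux_def mean_def)
qed

text \<open>On the diagonal the bracket becomes p / ((\<gamma> - 1) rho) + v^2 - v^2/2, the specific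
  total energy e; the remaining term supplies the pressure work p v.\<close>

lemma energy_flux_diagonal:
  assumes "\<gamma> > 1" "u \<in> states \<gamma>"
  shows "energy_flux \<gamma> j u u = (total_energy u + pressure \<gamma> u) * velocity j u"
proof -
  have pos: "mass_density u > 0" "pressure \<gamma> u > 0"
    using assms by (auto simp: states_def)
  have geo: "(geo_mean (pressure \<gamma>) u u)\<^sup>2 / (mean mass_density u u * log_mean (pressure \<gamma>) u u)
      = pressure \<gamma> u / mass_density u"
    using pos by (simp add: geo_mean_def mean_def log_mean_def power2_eq_square)
  have "mean mass_density u u * mean (velocity j) u u
      / mean (\<lambda>u. mass_density u / pressure \<gamma> u) u u = pressure \<gamma> u * velocity j u"
    using pos by (simp add: mean_def)
  then show ?thesis
    unfolding energy_flux_def geo mass_flux_diagonal[OF assms]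
    using pos assms(1) total_energy_eq[of \<gamma> u]
    by (simp add: mean_def speed_squared_def) (simp add: field_simps)
qed

lemma num_flux_consistent:
  assumes "\<gamma> > 1"
  shows "consistent \<gamma> j (num_flux \<gamma> j)"
  unfolding consistent_def
proof
  fix u assume "u \<in> states \<gamma>"
  note diag = pressure_flux_diagonal[OF this] mass_flux_diagonal[OF assms this]
    energy_flux_diagonal[OF assms this]
  show "num_flux \<gamma> j u u = physical_flux \<gamma> j u"
    by (cases j) (simp_all add: diag mean_def power2_eq_square mult_ac)
qed

text \<open>The momentum component has the required form whatever the value of the mass flux, hence
  also at pairs where \<open>flux_denominator\<close> is 0 and \<open>inverse\<close> returns
  0.\<close>

lemma num_flux_kinetic_energy_preserving:
  "kinetic_energy_preserving \<gamma> j (num_flux \<gamma> j) (pressure_flux \<gamma>)"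
  by (cases j) (simp_all add: kinetic_energy_preserving_def vector_4_nth pressure_flux_diagonal)

theorem mainTheorem5:
  fixes \<gamma> :: real
  assumes "\<gamma> > 1"
  shows "\<forall>j. entropy_conservative_on (flux_domain \<gamma>) \<gamma> j (num_flux \<gamma> j) \<and>
             consistent \<gamma> j (num_flux \<gamma> j) \<and>
             kinetic_energy_preserving \<gamma> j (num_flux \<gamma> j)
               (\<lambda>um up. mean mass_density um up / mean (\<lambda>u. mass_density u / pressure \<gamma> u) um up)"
  using num_flux_entropy_conservative[OF assms] num_flux_consistent[OF assms]
    num_flux_kinetic_energy_preserving[of \<gamma>]
  by (simp add: pressure_flux_def[abs_def])

end
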